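(* (Dynamic regret of inexact online gradient descent with absolute error.) Let $p\ge1$, $L>0$, $\alpha\ge 0$. For every $t\ge0$ let $0<m_t\le L_t$, $\sigma_t\ge0$, $c_t\ge0$, $\alpha\le\frac2{L_t}$, and let $f_t\in\mathcal S(m_t,L_t)$ be $L$-smooth with global minimizer $x_t^*\in\mathbb R^p$. Consider $x_{t+1}=x_t-\alpha(\nabla f_t(x_t)+v_t)$ and assume $\|x_{t+1}^*-x_t^*\|\le\sigma_t$ and $\|v_t\|\le c_t$ for all $t$. Suppose $\mu_t=\mu$ for all $t$, with $\mu<1$, and let $\hat U_0=\|x_0-x_0^*\|^2$. Then for every $T\ge0$, $$\sum_{t=0}^T\left(f_t(x_t)-f_t(x_t^* )\right)\le\frac{L}{(1-\mu)^2}\hat U_0+\frac{2L}{(1-\mu)^2}\left(\sum_{t=0}^{T-1}\sigma_t\right)^2+\frac{2L\alpha^2}{(1-\mu)^2}\left(\sum_{t=0}^{T-1}c_t\right)^2.$$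
   Context: $\mathcal S(m,L)$ is the set of differentiable functions $f:\mathbb R^p\to\mathbb R$ having a unique global minimizer $x^*$ such that for all $x\in\mathbb R^p$ $$\begin{bmatrix}x-x^*\\ \nabla f(x)\end{bmatrix}^T\begin{bmatrix}-2mLI_p&(L+m)I_p\\(L+m)I_p&-2I_p\end{bmatrix}\begin{bmatrix}x-x^*\\ \nabla f(x)\end{bmatrix}\ge0.$$ $\mu_t:=1-m_t\alpha$ if $0\le\alpha\le\frac{2}{m_t+L_t}$, and $\mu_t:=\alpha L_t-1$ if $\frac{2}{m_t+L_t}\le\alpha\le\frac{2}{L_t}$. $f$ is $L$-smooth if $\nabla f$ is $L$-Lipschitz. Empty sums are zero. *)

theory Defs
  imports "HOL-Analysis.Analysis"
begin

text \<open>\<^term>\<open>gradient f x\<close> is meaningful only where \<^term>\<open>f\<close> is differentiable; it is used below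
  only for functions that are differentiable everywhere.\<close>

definition gradient :: "('a::real_inner \<Rightarrow> real) \<Rightarrow> 'a \<Rightarrow> 'a" where
  "gradient f x = (THE D. GDERIV f x :> D)"

definition smooth :: "real \<Rightarrow> ('a::real_inner \<Rightarrow> real) \<Rightarrow> bool" where
  "smooth L f \<longleftrightarrow> (\<forall>x. f differentiable (at x)) \<and> L-lipschitz_on UNIV (gradient f)"

abbreviation global_minimizer :: "('a \<Rightarrow> real) \<Rightarrow> 'a \<Rightarrow> bool" where
  "global_minimizer f z \<equiv> is_arg_min f (\<lambda>_. True) z"

text \<open>Block vectors and 2-by-2 block matrices, with \<^typ>\<open>'n + 'm\<close> as the index type of the
  concatenated vector: \<^term>\<open>Inl\<close> indexes the upper (left) block, \<^term>\<open>Inr\<close> the lower (right) one.\<close>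

definition block_vec :: "real ^ 'n \<Rightarrow> real ^ 'm \<Rightarrow> real ^ ('n + 'm)" where
  "block_vec u v = (\<chi> i. case i of Inl k \<Rightarrow> u $ k | Inr k \<Rightarrow> v $ k)"

definition block_mat ::
  "real ^ 'n ^ 'n \<Rightarrow> real ^ 'm ^ 'n \<Rightarrow> real ^ 'n ^ 'm \<Rightarrow> real ^ 'm ^ 'm \<Rightarrow> real ^ ('n + 'm) ^ ('n + 'm)"
  where
  "block_mat A B C D = (\<chi> i j. case i of
      Inl k \<Rightarrow> (case j of Inl l \<Rightarrow> A $ k $ l | Inr l \<Rightarrow> B $ k $ l)
    | Inr k \<Rightarrow> (case j of Inl l \<Rightarrow> C $ k $ l | Inr l \<Rightarrow> D $ k $ l))"

definition sector_mat :: "real \<Rightarrow> real \<Rightarrow> real ^ ('n::finite + 'n) ^ ('n + 'n)" where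
  "sector_mat m L = block_mat
     ((- 2 * m * L) *\<^sub>R mat 1) ((L + m) *\<^sub>R mat 1)
     ((L + m) *\<^sub>R mat 1)      ((- 2) *\<^sub>R mat 1)"

definition sector_class :: "real \<Rightarrow> real \<Rightarrow> (real ^ 'n::finite \<Rightarrow> real) set" where
  "sector_class m L = {f. (\<forall>x. f differentiable (at x)) \<and>
     (\<exists>!z. global_minimizer f z) \<and>
     (\<forall>z. global_minimizer f z \<longrightarrow>
       (\<forall>x. block_vec (x - z) (gradient f x)
              \<bullet> (sector_mat m L *v block_vec (x - z) (gradient f x)) \<ge> 0))}"

text \<open>Intended for \<open>0 < m \<le> L\<close> and \<open>0 \<le> \<alpha> \<le> 2 / L\<close>; the two branches agree at \<open>\<alpha> = 2 / (m + L)\<close>.\<close>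

definition contraction_factor :: "real \<Rightarrow> real \<Rightarrow> real \<Rightarrow> real" where
  "contraction_factor m L \<alpha> = (if \<alpha> \<le> 2 / (m + L) then 1 - m * \<alpha> else \<alpha> * L - 1)"

end

(*
  The sector condition makes an exact gradient step on f_t contract the distance to its minimizer
  by the factor mu, so the tracking error e_t = |x_t - x*_t| satisfies
  e_{t+1} <= mu e_t + sigma_t + alpha c_t.  Summing this linear recursion bounds the sum of the e_t
  by (e_0 + sum sigma_t + alpha sum c_t) / (1 - mu).  Since the gradient vanishes at the minimizer,
  L-smoothness gives f_t(x_t) - f_t(x*_t) <= (L/2) e_t^2, and the regret is at most L/2 times the
  square of the sum of the e_t.
*)
theory Submission
  imports Defs
begin

lemma gradient_eqI:
  fixes f :: "'a::real_inner \<Rightarrow> real"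
  assumes "GDERIV f x :> D"
  shows "gradient f x = D"
  unfolding gradient_def
proof (rule the_equality)
  show "GDERIV f x :> D" by (fact assms)
next
  fix D' assume "GDERIV f x :> D'"
  then have "(\<lambda>h. h \<bullet> D') = (\<lambda>h. h \<bullet> D)"
    using assms has_derivative_unique unfolding gderiv_def by blast
  \<comment> \<open>Evaluating both functionals at \<open>D' - D\<close> makes the squared length of
    that vector vanish.\<close>
  then have "(D' - D) \<bullet> (D' - D) = 0"
    by (metis inner_diff_right right_minus_eq)
  then show "D' = D" by simp
qed

text \<open>In finite dimension the derivative is a linear functional, represented by the vector
  \<open>adjoint f' 1\<close>; hence the description in \<open>gradient\<close> does denote.\<close>

lemma GDERIV_gradient:
  fixes f :: "'a::euclidean_space \<Rightarrow> real"
  assumes "f differentiable (at x)"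
  shows "GDERIV f x :> gradient f x"
proof -
  obtain f' where f': "(f has_derivative f') (at x)"
    using assms unfolding differentiable_def by blast
  then have "linear f'" by (rule has_derivative_linear)
  then have "f' = (\<lambda>h. h \<bullet> adjoint f' 1)"
    by (auto simp: fun_eq_iff adjoint_works)
  with f' have "GDERIV f x :> adjoint f' 1"
    unfolding gderiv_def by simp
  then show ?thesis using gradient_eqI by metis
qed

lemma smooth_descent:
  fixes f :: "'a::euclidean_space \<Rightarrow> real"
  assumes "smooth L f"
  shows "f y \<le> f x + gradient f x \<bullet> (y - x) + L / 2 * (norm (y - x))\<^sup>2"
proof -
  define d where "d = y - x"
  \<comment> \<open>Along the segment from \<open>x\<close> to \<open>y\<close>,
    \<open>\<phi>\<close> is \<open>f\<close> minus the non-constant terms of its quadratic upper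
    model, so the claim is exactly \<open>\<phi> 1 \<le> \<phi> 0\<close>.\<close>
  define \<phi> where "\<phi> t = f (x + t *\<^sub>R d) - t * (gradient f x \<bullet> d) - L / 2 * t\<^sup>2 * (norm d)\<^sup>2"
    for t :: real
  have "\<phi> 1 \<le> \<phi> 0"
  proof (rule DERIV_nonpos_imp_nonincreasing[where f = \<phi>])
    fix t :: real assume t: "0 \<le> t" "t \<le> 1"
    let ?z = "x + t *\<^sub>R d"
    have "(f has_derivative (\<lambda>h. h \<bullet> gradient f ?z)) (at ?z)"
      using assms GDERIV_gradient unfolding smooth_def gderiv_def by blast
    then have "((\<lambda>t. f (x + t *\<^sub>R d)) has_derivative (\<lambda>s. (s *\<^sub>R d) \<bullet> gradient f ?z)) (at t)"
      by (rule has_derivative_compose[rotated]) (auto intro!: derivative_eq_intros)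
    moreover have "(\<lambda>s. (s *\<^sub>R d) \<bullet> gradient f ?z) = (*) (gradient f ?z \<bullet> d)"
      by (auto simp: inner_commute)
    ultimately have "((\<lambda>t. f (x + t *\<^sub>R d)) has_real_derivative gradient f ?z \<bullet> d) (at t)"
      by (simp add: has_field_derivative_def)
    then have "(\<phi> has_real_derivative
        gradient f ?z \<bullet> d - gradient f x \<bullet> d - L * t * (norm d)\<^sup>2) (at t)"
      unfolding \<phi>_def by (auto intro!: derivative_eq_intros)
    moreover have "gradient f ?z \<bullet> d - gradient f x \<bullet> d - L * t * (norm d)\<^sup>2 \<le> 0"
    proof -
      have "(gradient f ?z - gradient f x) \<bullet> d \<le> norm (gradient f ?z - gradient f x) * norm d"
        by (rule norm_cauchy_schwarz)
      also have "\<dots> \<le> (L * (t * norm d)) * norm d"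
        using assms t lipschitz_onD[of L UNIV "gradient f" ?z x]
        by (intro mult_right_mono) (auto simp: smooth_def dist_norm)
      finally show ?thesis by (simp add: inner_diff_left power2_eq_square algebra_simps)
    qed
    ultimately show "\<exists>y. (\<phi> has_real_derivative y) (at t) \<and> y \<le> 0" by blast
  qed simp
  then show ?thesis by (simp add: \<phi>_def d_def)
qed

text \<open>The index type is a disjoint sum, so sums over it split into the \<open>Inl\<close> and
  \<open>Inr\<close> halves.\<close>

lemma inner_block_vec:
  "block_vec u w \<bullet> block_vec u' w' = u \<bullet> u' + w \<bullet> w'"
  by (simp add: inner_vec_def block_vec_def UNIV_Plus_UNIV[symmetric] sum.Plus
           del: UNIV_Plus_UNIV)

lemma block_mat_mult_block_vec:
  "block_mat A B C D *v block_vec u w = block_vec (A *v u + B *v w) (C *v u + D *v w)"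
  by (auto simp: vec_eq_iff matrix_vector_mult_def block_vec_def block_mat_def
      UNIV_Plus_UNIV[symmetric] sum.Plus simp del: UNIV_Plus_UNIV split: sum.split)

text \<open>Turns the matrix condition into norms and an inner product. The factor 2 collects the
  two equal off-diagonal contributions and the doubled diagonal blocks.\<close>

lemma sector_mat_quadratic_form:
  "block_vec u w \<bullet> (sector_mat m L *v block_vec u w)
     = 2 * ((L + m) * (u \<bullet> w) - m * L * (norm u)\<^sup>2 - (norm w)\<^sup>2)"
  unfolding sector_mat_def block_mat_mult_block_vec inner_block_vec
    scaleR_matrix_vector_assoc[symmetric] matrix_vector_mul_lid power2_norm_eq_inner
  by (simp add: inner_diff_right inner_add_right inner_commute[of w u] algebra_simps)

lemma sector_classD:
  assumes "f \<in> sector_class m L" "global_minimizer f z"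
  shows "m * L * (norm (x - z))\<^sup>2 + (norm (gradient f x))\<^sup>2
           \<le> (L + m) * ((x - z) \<bullet> gradient f x)"
proof -
  have "block_vec (x - z) (gradient f x)
          \<bullet> (sector_mat m L *v block_vec (x - z) (gradient f x)) \<ge> 0"
    using assms unfolding sector_class_def by blast
  then show ?thesis unfolding sector_mat_quadratic_form by simp
qed

text \<open>At \<open>x = z\<close> every term containing \<open>x - z\<close> vanishes, and the
  sector inequality leaves only the squared norm of the gradient, bounded by 0.\<close>

lemma gradient_global_minimizer_eq_0:
  assumes "f \<in> sector_class m L" "global_minimizer f z"
  shows "gradient f z = 0"
  using sector_classD[OF assms, of z] by simp

text \<open>At the threshold \<open>2 / (m + L)\<close>, \<open>m * \<alpha>\<close> is at most 1
  and \<open>\<alpha> * L\<close> at least 1; each branch lies on the matching side. The sign is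
  needed for taking square roots and for unrolling the error recursion.\<close>

lemma contraction_factor_nonneg:
  assumes "0 < m" "m \<le> L"
  shows "0 \<le> contraction_factor m L \<alpha>"
proof (cases "\<alpha> \<le> 2 / (m + L)")
  case True
  then have "m * \<alpha> \<le> m * (2 / (m + L))" using assms by (intro mult_left_mono) auto
  also have "\<dots> \<le> 1" using assms by (simp add: field_simps)
  finally show ?thesis using True by (simp add: contraction_factor_def)
next
  case False
  have "1 \<le> 2 / (m + L) * L" using assms by (simp add: field_simps)
  also have "\<dots> \<le> \<alpha> * L" using False assms by (intro mult_right_mono) auto
  finally show ?thesis using False by (simp add: contraction_factor_def)
qed

text \<open>By Cauchy-Schwarz the sector inequality becomes a quadratic in \<open>norm w\<close>
  with roots \<open>m * norm u\<close> and \<open>L * norm u\<close>; being nonpositive, it traps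
  \<open>norm w\<close> between them.\<close>

lemma sector_norm_bounds:
  fixes u w :: "'a::real_inner"
  assumes "0 < m" "m \<le> L"
    and "m * L * (norm u)\<^sup>2 + (norm w)\<^sup>2 \<le> (L + m) * (u \<bullet> w)"
  shows "m * norm u \<le> norm w" and "norm w \<le> L * norm u"
proof -
  have "(L + m) * (u \<bullet> w) \<le> (L + m) * (norm u * norm w)"
    using assms norm_cauchy_schwarz by (intro mult_left_mono) auto
  with assms(3) have *: "(norm w - m * norm u) * (norm w - L * norm u) \<le> 0"
    by (simp add: power2_eq_square algebra_simps)
  have "m * norm u \<le> L * norm u" using assms by (intro mult_right_mono) auto
  with * show "m * norm u \<le> norm w" "norm w \<le> L * norm u"
    unfolding mult_le_0_iff by linarith+
qed

lemma sector_step_contraction: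
  fixes u w :: "'a::real_inner"
  assumes "0 < m" "m \<le> L" "0 \<le> \<alpha>"
    and sector: "m * L * (norm u)\<^sup>2 + (norm w)\<^sup>2 \<le> (L + m) * (u \<bullet> w)"
  shows "norm (u - \<alpha> *\<^sub>R w) \<le> contraction_factor m L \<alpha> * norm u"
proof -
  have S: "0 < m + L" using assms by simp
  have expand: "(norm (u - \<alpha> *\<^sub>R w))\<^sup>2 = (norm u)\<^sup>2 - 2 * \<alpha> * (u \<bullet> w) + \<alpha>\<^sup>2 * (norm w)\<^sup>2"
    unfolding power2_norm_eq_inner
    by (simp add: inner_diff_left inner_diff_right inner_commute[of w u] power2_eq_square
        algebra_simps)
  \<comment> \<open>The weight \<open>2 * \<alpha>\<close> matches the cross term of
    \<open>expand\<close> multiplied by \<open>m + L\<close>, which eliminates the inner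
    product.\<close>
  have "2 * \<alpha> * (m * L * (norm u)\<^sup>2 + (norm w)\<^sup>2) \<le> 2 * \<alpha> * ((L + m) * (u \<bullet> w))"
    using sector assms by (intro mult_left_mono) auto
  then have bound: "(m + L) * (norm (u - \<alpha> *\<^sub>R w))\<^sup>2
      \<le> (m + L - 2 * \<alpha> * m * L) * (norm u)\<^sup>2 + \<alpha> * (\<alpha> * (m + L) - 2) * (norm w)\<^sup>2"
    unfolding expand by (simp add: power2_eq_square algebra_simps)
  have "(m + L) * (norm (u - \<alpha> *\<^sub>R w))\<^sup>2 \<le> (m + L) * (contraction_factor m L \<alpha> * norm u)\<^sup>2"
  proof (cases "\<alpha> \<le> 2 / (m + L)")
    case True
    \<comment> \<open>The coefficient of \<open>(norm w)\<^sup>2\<close> is nonpositive, so the lower bound on \<open>norm w\<close> applies;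
      in the other case it is positive and the upper bound does.\<close>
    then have "\<alpha> * (\<alpha> * (m + L) - 2) \<le> 0"
      using assms S by (intro mult_nonneg_nonpos) (auto simp: field_simps)
    moreover have "(m * norm u)\<^sup>2 \<le> (norm w)\<^sup>2"
      using sector_norm_bounds(1)[OF assms(1,2) sector] assms by (intro power_mono) auto
    ultimately have "\<alpha> * (\<alpha> * (m + L) - 2) * (norm w)\<^sup>2 \<le> \<alpha> * (\<alpha> * (m + L) - 2) * (m * norm u)\<^sup>2"
      by (rule mult_left_mono_neg[rotated])
    with bound have "(m + L) * (norm (u - \<alpha> *\<^sub>R w))\<^sup>2
      \<le> (m + L - 2 * \<alpha> * m * L) * (norm u)\<^sup>2 + \<alpha> * (\<alpha> * (m + L) - 2) * (m * norm u)\<^sup>2" by linarith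
    \<comment> \<open>The coefficients combine to a perfect square, and likewise with
      \<open>L\<close> in the other case: this is the origin of the two branches of
      \<open>contraction_factor\<close>.\<close>
    also have "\<dots> = (m + L) * ((1 - m * \<alpha>) * norm u)\<^sup>2"
      by (simp add: power2_eq_square algebra_simps)
    finally show ?thesis using True by (simp add: contraction_factor_def)
  next
    case False
    then have "\<alpha> * (\<alpha> * (m + L) - 2) \<ge> 0"
      using assms S by (intro mult_nonneg_nonneg) (auto simp: field_simps)
    moreover have "(norm w)\<^sup>2 \<le> (L * norm u)\<^sup>2"
      using sector_norm_bounds(2)[OF assms(1,2) sector] by (intro power_mono) auto
    ultimately have "\<alpha> * (\<alpha> * (m + L) - 2) * (norm w)\<^sup>2 \<le> \<alpha> * (\<alpha> * (m + L) - 2) * (L * norm u)\<^sup>2"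
      by (rule mult_left_mono[rotated])
    with bound have "(m + L) * (norm (u - \<alpha> *\<^sub>R w))\<^sup>2
      \<le> (m + L - 2 * \<alpha> * m * L) * (norm u)\<^sup>2 + \<alpha> * (\<alpha> * (m + L) - 2) * (L * norm u)\<^sup>2" by linarith
    also have "\<dots> = (m + L) * ((\<alpha> * L - 1) * norm u)\<^sup>2"
      by (simp add: power2_eq_square algebra_simps)
    finally show ?thesis using False by (simp add: contraction_factor_def)
  qed
  then have "(norm (u - \<alpha> *\<^sub>R w))\<^sup>2 \<le> (contraction_factor m L \<alpha> * norm u)\<^sup>2"
    using S by simp
  then show ?thesis
    by (rule power2_le_imp_le) (simp add: contraction_factor_nonneg assms)
qed

text \<open>Summing the recursion bounds the total \<open>S\<close> by \<open>e 0 + q * S\<close>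
  plus the sum of the \<open>b t\<close>; solving for \<open>S\<close> replaces any geometric
  series.\<close>

lemma sum_linear_recursion_le:
  fixes e b :: "nat \<Rightarrow> real"
  assumes "\<And>t. 0 \<le> e t" "\<And>t. e (Suc t) \<le> q * e t + b t" "0 \<le> q" "q < 1"
  shows "(\<Sum>t\<le>T. e t) \<le> (e 0 + (\<Sum>t<T. b t)) / (1 - q)"
proof -
  have "(\<Sum>t\<le>T. e t) = e 0 + (\<Sum>t<T. e (Suc t))" by (rule sum.atMost_shift)
  also have "(\<Sum>t<T. e (Suc t)) \<le> (\<Sum>t<T. q * e t + b t)"
    using assms by (intro sum_mono) auto
  also have "\<dots> = q * (\<Sum>t<T. e t) + (\<Sum>t<T. b t)"
    by (simp add: sum.distrib sum_distrib_left)
  \<comment> \<open>Adding the nonnegative last term puts the same sum on both sides.\<close>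
  also have "q * (\<Sum>t<T. e t) \<le> q * (\<Sum>t\<le>T. e t)"
    using assms by (intro mult_left_mono sum_mono2) auto
  finally show ?thesis using assms by (simp add: field_simps)
qed

text \<open>Each \<open>e i\<close> is at most the total. For infinite \<open>A\<close> both sums
  are 0 by convention.\<close>

lemma sum_power2_le_power2_sum:
  fixes e :: "'i \<Rightarrow> real"
  assumes "\<And>i. i \<in> A \<Longrightarrow> 0 \<le> e i"
  shows "(\<Sum>i\<in>A. (e i)\<^sup>2) \<le> (\<Sum>i\<in>A. e i)\<^sup>2"
proof (cases "finite A")
  case True
  then have "(\<Sum>i\<in>A. e i * e i) \<le> (\<Sum>i\<in>A. e i * (\<Sum>i\<in>A. e i))"
    using assms by (intro sum_mono mult_left_mono member_le_sum) auto
  then show ?thesis by (simp add: power2_eq_square sum_distrib_right)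
qed simp

theorem mainTheorem15:
  fixes f :: "nat \<Rightarrow> real ^ 'n \<Rightarrow> real"
    and x xstar v :: "nat \<Rightarrow> real ^ 'n"
    and m Ls \<sigma> c :: "nat \<Rightarrow> real"
    and L \<alpha> \<mu> U0 :: real
    and T :: nat
  assumes "L > 0" and "\<alpha> \<ge> 0"
    and "\<And>t. 0 < m t" and "\<And>t. m t \<le> Ls t"
    and "\<And>t. \<sigma> t \<ge> 0" and "\<And>t. c t \<ge> 0"
    and "\<And>t. \<alpha> \<le> 2 / Ls t"
    and "\<And>t. f t \<in> sector_class (m t) (Ls t)"
    and "\<And>t. smooth L (f t)"
    and "\<And>t. global_minimizer (f t) (xstar t)"
    and "\<And>t. x (Suc t) = x t - \<alpha> *\<^sub>R (gradient (f t) (x t) + v t)"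
    and "\<And>t. norm (xstar (Suc t) - xstar t) \<le> \<sigma> t"
    and "\<And>t. norm (v t) \<le> c t"
    and "\<And>t. contraction_factor (m t) (Ls t) \<alpha> = \<mu>"
    and "\<mu> < 1"
    and "U0 = (norm (x 0 - xstar 0))\<^sup>2"
  shows "(\<Sum>t=0..T. f t (x t) - f t (xstar t))
    \<le> L / (1 - \<mu>)\<^sup>2 * U0
      + 2 * L / (1 - \<mu>)\<^sup>2 * (\<Sum>t<T. \<sigma> t)\<^sup>2
      + 2 * L * \<alpha>\<^sup>2 / (1 - \<mu>)\<^sup>2 * (\<Sum>t<T. c t)\<^sup>2"
proof -
  define e where "e t = norm (x t - xstar t)" for t
  have \<mu>: "0 \<le> \<mu>"
    using contraction_factor_nonneg[OF assms(3,4)] assms(14) by metis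
  have rec: "e (Suc t) \<le> \<mu> * e t + (\<sigma> t + \<alpha> * c t)" for t
  proof -
    let ?g = "gradient (f t) (x t)"
    \<comment> \<open>The new error splits into the exact gradient step, the drift of the minimizer
      and the gradient noise, each bounded separately.\<close>
    have "x (Suc t) - xstar (Suc t)
        = (x t - xstar t - \<alpha> *\<^sub>R ?g) - (xstar (Suc t) - xstar t) - \<alpha> *\<^sub>R v t"
      by (simp add: assms(11) algebra_simps)
    then have "e (Suc t) \<le> norm (x t - xstar t - \<alpha> *\<^sub>R ?g)
        + norm (xstar (Suc t) - xstar t) + norm (\<alpha> *\<^sub>R v t)"
      unfolding e_def
      by (simp only:) (rule order.trans[OF norm_triangle_ineq4 add_right_mono[OF norm_triangle_ineq4]])
    moreover have "norm (x t - xstar t - \<alpha> *\<^sub>R ?g) \<le> \<mu> * e t"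
      using sector_step_contraction[OF assms(3,4,2) sector_classD[OF assms(8,10)]] assms(14)
      unfolding e_def by metis
    moreover have "norm (\<alpha> *\<^sub>R v t) \<le> \<alpha> * c t"
      using assms(2,13) by (simp add: mult_left_mono)
    ultimately show ?thesis using assms(12)[of t] by linarith
  qed
  have "f t (x t) - f t (xstar t) \<le> L / 2 * (e t)\<^sup>2" for t
    using smooth_descent[OF assms(9)[of t], of "x t" "xstar t"]
      gradient_global_minimizer_eq_0[OF assms(8,10)[of t]] by (simp add: e_def)
  then have "(\<Sum>t=0..T. f t (x t) - f t (xstar t)) \<le> (\<Sum>t=0..T. L / 2 * (e t)\<^sup>2)"
    by (intro sum_mono)
  also have "\<dots> = L / 2 * (\<Sum>t\<le>T. (e t)\<^sup>2)"
    by (simp add: sum_distrib_left atLeast0AtMost)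
  also have "\<dots> \<le> L / 2 * (\<Sum>t\<le>T. e t)\<^sup>2"
    using assms(1) by (intro mult_left_mono sum_power2_le_power2_sum) (auto simp: e_def)
  also have "\<dots> \<le> L / 2 * ((e 0 + (\<Sum>t<T. \<sigma> t + \<alpha> * c t)) / (1 - \<mu>))\<^sup>2"
    using assms(1) \<mu> assms(15)
    by (intro mult_left_mono power_mono sum_linear_recursion_le rec sum_nonneg) (auto simp: e_def)
  also have "\<dots> = L / 2 / (1 - \<mu>)\<^sup>2 * (e 0 + (\<Sum>t<T. \<sigma> t) + \<alpha> * (\<Sum>t<T. c t))\<^sup>2"
    by (simp add: sum.distrib sum_distrib_left power_divide add.assoc)
  also have "\<dots> \<le> L / 2 / (1 - \<mu>)\<^sup>2
      * (2 * (e 0)\<^sup>2 + 4 * (\<Sum>t<T. \<sigma> t)\<^sup>2 + 4 * (\<alpha> * (\<Sum>t<T. c t))\<^sup>2)"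
  proof (rule mult_left_mono)
    \<comment> \<open>Separating first \<open>a\<close> from \<open>b + d\<close>, then
      \<open>b\<close> from \<open>d\<close>, doubles the weights each time; multiplied by
      \<open>L / 2\<close>, the weights 2, 4, 4 become the constants \<open>L\<close>,
      \<open>2 * L\<close>, \<open>2 * L\<close> of the claim.\<close>
    have "(a + b + d)\<^sup>2 \<le> 2 * a\<^sup>2 + 4 * b\<^sup>2 + 4 * d\<^sup>2" for a b d :: real
      using zero_le_power2[of "a - (b + d)"] zero_le_power2[of "b - d"]
      by (simp add: power2_eq_square algebra_simps)
    then show "(e 0 + (\<Sum>t<T. \<sigma> t) + \<alpha> * (\<Sum>t<T. c t))\<^sup>2
        \<le> 2 * (e 0)\<^sup>2 + 4 * (\<Sum>t<T. \<sigma> t)\<^sup>2 + 4 * (\<alpha> * (\<Sum>t<T. c t))\<^sup>2" .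
  qed (use assms(1) in simp)
  also have "\<dots> = L / (1 - \<mu>)\<^sup>2 * U0
      + 2 * L / (1 - \<mu>)\<^sup>2 * (\<Sum>t<T. \<sigma> t)\<^sup>2
      + 2 * L * \<alpha>\<^sup>2 / (1 - \<mu>)\<^sup>2 * (\<Sum>t<T. c t)\<^sup>2"
    using assms(15) unfolding assms(16) e_def by (simp add: field_simps)
  finally show ?thesis .
qed

end
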